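(* Let $F$ and $F'$ be immersed surface-links in $\mathbb{R}^4$, each having at least one transverse double point. If $F$ and $F'$ are equivalent, then their mosaic numbers agree: $m(F)=m(F')$. That is, the mosaic number is an invariant of immersed surface-links.
   Context: An immersed surface-link is the image of a closed surface (not necessarily connected or orientable) smoothly immersed in $\mathbb{R}^4$ such that the multiple points are transverse double points. Two immersed surface-links $F,F'$ are equivalent if there is an orientation-preserving homeomorphism $h:\mathbb{R}^4\to\mathbb{R}^4$ with $h(F)=F'$. Singular marked graph diagrams. A singular marked graph diagram $D$ is a diagram in $\mathbb{R}^2$ (a generically immersed 4-valent plane picture, as for link diagrams) each of whose 4-valent points is one of: a classical crossing (with over/under information); a marked vertex, i.e. a vertex decorated with a short line segment (marker) lying in one of the two pairs of opposite local regions at the vertex; or a singular vertex, i.e. a vertex decorated with a circle symbol which singles out one of the two transverse strands as the strand drawn unbroken inside the circle, the other strand being broken by the circle. The positive resolution $L_+(D)$ is the link diagram obtained by splicing each marked vertex in the direction consistent with its marker (so that the two local regions containing the ends of the marker are merged and the two resulting arcs run parallel to the marker) and replacing each singular vertex by the classical crossing in which the strand drawn unbroken in the circle is the over-strand. The negative resolution $L_-(D)$ is obtained by splicing each marked vertex in the other way and replacing each singular vertex by the opposite crossing. $D$ is admissible if both $L_+(D)$ and $L_-(D)$ are diagrams of trivial links. The surface of a diagram. For admissible $D$, the immersed surface-link $F(D)\subset\mathbb{R}^4=\mathbb{R}^3\times\mathbb{R}$ is constructed as follows: for $0<t\le 1$ its cross-section in $\mathbb{R}^3\times\{t\}$ is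 the link $L_+(D)$, for $-1\le t<0$ it is $L_-(D)$ (up to the local change at singular vertices), at $t=0$ a saddle band is attached at each marked vertex and the two strands at each singular vertex cross each other, giving exactly one transverse double point per singular vertex; finally $L_+(D)$ and $L_-(D)$ are capped off by systems of disjoint trivial disks in $\mathbb{R}^3\times[1,\infty)$ and $\mathbb{R}^3\times(-\infty,-1]$. $F(D)$ is well defined up to equivalence, and every immersed surface-link is equivalent to $F(D)$ for some admissible $D$. Mosaics. The mosaic tiles $T_0,\dots,T_{14}$ are squares whose arcs have endpoints (connection points) at midpoints of edges: $T_0$ is empty; $T_1,\dots,T_4$ contain one arc joining the midpoints of two adjacent edges (four rotations); $T_5,T_6$ contain one straight arc joining midpoints of opposite edges (horizontal, vertical); $T_7,T_8$ contain two disjoint arcs, each joining midpoints of adjacent edges (two rotations); $T_9,T_{10}$ contain a horizontal and a vertical strand meeting in a classical crossing (two choices); $T_{11},T_{12}$ contain a horizontal and a vertical strand meeting in a marked vertex (two choices of marker); $T_{13},T_{14}$ contain a horizontal and a vertical strand meeting in a singular vertex (two choices). An $n$-mosaic is an $n\times n$ matrix of such tiles. A tile in a mosaic is suitably connected if each of its connection points coincides with a connection point of a contiguous tile (one adjacent in the same row or column); in particular it has no connection point on the outer boundary of the mosaic. A singular marked graph $n$-mosaic is an $n$-mosaic all of whose tiles are suitably connected; it depicts a singular marked graph diagram. Mosaic number. An immersed surface-link $F$ is represented by an $n$-mosaic if there is a singular marked graph $n$-mosaic depicting an admissible diagram $D$ with $F(D)$ equivalent to $F$. The mosaic number $m(F)$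 is the smallest integer $n$ for which $F$ can be represented by an $n$-mosaic. *)

theory Defs
  imports "HOL-Analysis.Analysis" "HOL-Homology.Homology"
begin

type_synonym R2 = "real \<times> real"
type_synonym R3 = "real \<times> real \<times> real"
type_synonym R4 = "R3 \<times> real"


section \<open>Equivalence of subsets of Euclidean space\<close>

text \<open>
  A homeomorphism preserves orientation iff at every point \<open>a\<close> it maps the local orientation at \<open>a\<close>
  to the local orientation at \<open>h a\<close>. Local homology at different points is identified by
  translation, so this is a condition on the top relative homology group of the space modulo
  the complement of the origin, an infinite cyclic group on which a homeomorphism acts by a sign.
\<close>

definition orientation_preserving :: "('a::euclidean_space \<Rightarrow> 'a) \<Rightarrow> bool" where
  "orientation_preserving h \<longleftrightarrow>
     (\<forall>a. \<forall>c \<in> carrier (relative_homology_group (int DIM('a)) euclidean (- {0 :: 'a})).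
        hom_induced (int DIM('a)) euclidean (- {0}) euclidean (- {0})
          (\<lambda>x. h (a + x) - h a) c = c)"

definition orientation_preserving_homeo :: "('a::euclidean_space \<Rightarrow> 'a) \<Rightarrow> bool" where
  "orientation_preserving_homeo h \<longleftrightarrow>
     (\<exists>g. homeomorphism UNIV UNIV h g) \<and> orientation_preserving h"

definition equivalent :: "'a::euclidean_space set \<Rightarrow> 'a set \<Rightarrow> bool" where
  "equivalent F F' \<longleftrightarrow> (\<exists>h. orientation_preserving_homeo h \<and> h ` F = F')"


section \<open>Immersed surface-links\<close>

text \<open>The following two predicates are meant for open sets \<open>S\<close> only.\<close>

primrec Ck_on :: "nat \<Rightarrow> 'a::euclidean_space set \<Rightarrow> ('a \<Rightarrow> 'b::euclidean_space) \<Rightarrow> bool" where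
  "Ck_on 0 S f \<longleftrightarrow> continuous_on S f"
| "Ck_on (Suc k) S f \<longleftrightarrow>
     f differentiable_on S \<and> (\<forall>v. Ck_on k S (\<lambda>x. frechet_derivative f (at x) v))"

definition smooth_on :: "'a::euclidean_space set \<Rightarrow> ('a \<Rightarrow> 'b::euclidean_space) \<Rightarrow> bool" where
  "smooth_on S f \<longleftrightarrow> (\<forall>k. Ck_on k S f)"

type_synonym 'a chart = "'a set \<times> ('a \<Rightarrow> R2)"

definition smooth_atlas :: "'a topology \<Rightarrow> 'a chart set \<Rightarrow> bool" where
  "smooth_atlas X \<A> \<longleftrightarrow>
     (\<Union>(U, \<phi>) \<in> \<A>. U) = topspace X \<and>
     (\<forall>(U, \<phi>) \<in> \<A>. openin X U \<and> open (\<phi> ` U) \<and>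
        homeomorphic_map (subtopology X U) (top_of_set (\<phi> ` U)) \<phi>) \<and>
     (\<forall>(U, \<phi>) \<in> \<A>. \<forall>(V, \<psi>) \<in> \<A>. smooth_on (\<phi> ` (U \<inter> V)) (\<psi> \<circ> inv_into U \<phi>))"

text \<open>Second countability follows from compactness.\<close>

definition closed_surface :: "'a topology \<Rightarrow> 'a chart set \<Rightarrow> bool" where
  "closed_surface X \<A> \<longleftrightarrow> compact_space X \<and> Hausdorff_space X \<and> smooth_atlas X \<A>"

definition chart_deriv :: "('a \<Rightarrow> R4) \<Rightarrow> 'a chart \<Rightarrow> 'a \<Rightarrow> R2 \<Rightarrow> R4" where
  "chart_deriv f c p = (case c of (U, \<phi>) \<Rightarrow> frechet_derivative (f \<circ> inv_into U \<phi>) (at (\<phi> p)))"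

definition smooth_immersion :: "'a topology \<Rightarrow> 'a chart set \<Rightarrow> ('a \<Rightarrow> R4) \<Rightarrow> bool" where
  "smooth_immersion X \<A> f \<longleftrightarrow>
     continuous_map X euclidean f \<and>
     (\<forall>(U, \<phi>) \<in> \<A>. smooth_on (\<phi> ` U) (f \<circ> inv_into U \<phi>) \<and>
        (\<forall>p \<in> U. inj (chart_deriv f (U, \<phi>) p)))"

definition transverse_double_point ::
    "'a topology \<Rightarrow> 'a chart set \<Rightarrow> ('a \<Rightarrow> R4) \<Rightarrow> 'a \<Rightarrow> 'a \<Rightarrow> bool" where
  "transverse_double_point X \<A> f p q \<longleftrightarrow>
     p \<noteq> q \<and> {r \<in> topspace X. f r = f p} = {p, q} \<and>
     (\<forall>c \<in> \<A>. \<forall>d \<in> \<A>. p \<in> fst c \<and> q \<in> fst d \<longrightarrow>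
        {v + w | v w. v \<in> range (chart_deriv f c p) \<and> w \<in> range (chart_deriv f d q)} = UNIV)"

definition immersed_surface :: "'a topology \<Rightarrow> 'a chart set \<Rightarrow> ('a \<Rightarrow> R4) \<Rightarrow> bool" where
  "immersed_surface X \<A> f \<longleftrightarrow>
     closed_surface X \<A> \<and> smooth_immersion X \<A> f \<and>
     (\<forall>p \<in> topspace X. \<forall>q \<in> topspace X. p \<noteq> q \<and> f p = f q \<longrightarrow>
        transverse_double_point X \<A> f p q)"

text \<open>
  The abstract surface has its points in the type \<^typ>\<open>real\<close>, with an arbitrary topology on an
  arbitrary set of reals. This is no restriction: a closed surface has at most the cardinality
  of the continuum.
\<close>

definition immersed_surface_link :: "R4 set \<Rightarrow> bool" where
  "immersed_surface_link F \<longleftrightarrow>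
     (\<exists>(X :: real topology) \<A> f. immersed_surface X \<A> f \<and> F = f ` topspace X)"

definition double_points :: "R4 set \<Rightarrow> R4 set" where
  "double_points F =
     {y. \<exists>(X :: real topology) \<A> f. immersed_surface X \<A> f \<and> F = f ` topspace X \<and>
        (\<exists>p \<in> topspace X. \<exists>q \<in> topspace X. transverse_double_point X \<A> f p q \<and> f p = y)}"


section \<open>Mosaics\<close>

datatype side = North | East | South | West
datatype corner = NW | NE | SE | SW
datatype axis = Horizontal | Vertical
datatype diagonal = NE_SW | NW_SE

fun other_axis :: "axis \<Rightarrow> axis" where
  "other_axis Horizontal = Vertical"
| "other_axis Vertical = Horizontal"

fun other_diagonal :: "diagonal \<Rightarrow> diagonal" where
  "other_diagonal NE_SW = NW_SE"
| "other_diagonal NW_SE = NE_SW"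

text \<open>
  \<open>Arc c\<close> joins the two edges meeting in the corner \<open>c\<close>; the two arcs of \<open>DoubleArc d\<close> run
  parallel to the diagonal \<open>d\<close>, that is, they cut off the two corners not on \<open>d\<close>.
  In \<open>Crossing a\<close> the strand along \<open>a\<close> is the over-strand; in \<open>Marked d\<close> the marker lies along
  \<open>d\<close>; in \<open>Singular a\<close> the strand along \<open>a\<close> is drawn unbroken inside the circle.
\<close>

datatype classical_tile =
  Blank | Arc corner | Line axis | DoubleArc diagonal | Crossing axis

datatype tile = Classical classical_tile | Marked diagonal | Singular axis

text \<open>
  Only the entries with indices below \<open>n\<close> of an \<open>n\<close>-mosaic are relevant. The first index is the row,
  counted from the top, the second one the column, counted from the left.
\<close>

type_synonym mosaic = "nat \<Rightarrow> nat \<Rightarrow> tile"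

fun corner_sides :: "corner \<Rightarrow> side set" where
  "corner_sides NW = {North, West}"
| "corner_sides NE = {North, East}"
| "corner_sides SE = {South, East}"
| "corner_sides SW = {South, West}"

fun axis_sides :: "axis \<Rightarrow> side set" where
  "axis_sides Horizontal = {East, West}"
| "axis_sides Vertical = {North, South}"

fun connection_points :: "tile \<Rightarrow> side set" where
  "connection_points (Classical Blank) = {}"
| "connection_points (Classical (Arc c)) = corner_sides c"
| "connection_points (Classical (Line a)) = axis_sides a"
| "connection_points _ = UNIV"

definition suitably_connected :: "nat \<Rightarrow> mosaic \<Rightarrow> nat \<Rightarrow> nat \<Rightarrow> bool" where
  "suitably_connected n M i j \<longleftrightarrow>
     (North \<in> connection_points (M i j) \<longrightarrow> 0 < i \<and> South \<in> connection_points (M (i - 1) j)) \<and>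
     (South \<in> connection_points (M i j) \<longrightarrow> i + 1 < n \<and> North \<in> connection_points (M (i + 1) j)) \<and>
     (West \<in> connection_points (M i j) \<longrightarrow> 0 < j \<and> East \<in> connection_points (M i (j - 1))) \<and>
     (East \<in> connection_points (M i j) \<longrightarrow> j + 1 < n \<and> West \<in> connection_points (M i (j + 1)))"

definition singular_marked_graph_mosaic :: "nat \<Rightarrow> mosaic \<Rightarrow> bool" where
  "singular_marked_graph_mosaic n M \<longleftrightarrow> (\<forall>i < n. \<forall>j < n. suitably_connected n M i j)"

fun positive_tile :: "tile \<Rightarrow> classical_tile" where
  "positive_tile (Classical k) = k"
| "positive_tile (Marked d) = DoubleArc d"
| "positive_tile (Singular a) = Crossing a"

fun negative_tile :: "tile \<Rightarrow> classical_tile" where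
  "negative_tile (Classical k) = k"
| "negative_tile (Marked d) = DoubleArc (other_diagonal d)"
| "negative_tile (Singular a) = Crossing (other_axis a)"

definition positive_resolution :: "mosaic \<Rightarrow> nat \<Rightarrow> nat \<Rightarrow> classical_tile" where
  "positive_resolution M i j = positive_tile (M i j)"

definition negative_resolution :: "mosaic \<Rightarrow> nat \<Rightarrow> nat \<Rightarrow> classical_tile" where
  "negative_resolution M i j = negative_tile (M i j)"


section \<open>The link of a classical mosaic\<close>

text \<open>
  A tile occupies the square of side length 2 around the origin of the \<open>xy\<close>-plane, with East and
  North in the directions of the positive \<open>x\<close>- and \<open>y\<close>-axis; the \<open>z\<close>-axis points to the viewer,
  so that over-strands have the larger \<open>z\<close>-coordinate.
\<close>

fun midpoint_of :: "side \<Rightarrow> R3" where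
  "midpoint_of North = (0, 1, 0)"
| "midpoint_of East = (1, 0, 0)"
| "midpoint_of South = (0, -1, 0)"
| "midpoint_of West = (-1, 0, 0)"

definition corner_arc :: "corner \<Rightarrow> R3 set" where
  "corner_arc c = convex hull (midpoint_of ` corner_sides c)"

fun double_arc :: "diagonal \<Rightarrow> R3 set" where
  "double_arc NE_SW = corner_arc NW \<union> corner_arc SE"
| "double_arc NW_SE = corner_arc NE \<union> corner_arc SW"

text \<open>The strand along an axis which passes the centre of the tile at height \<open>z\<close>.\<close>

definition strand :: "axis \<Rightarrow> real \<Rightarrow> R3 set" where
  "strand a z = (\<Union>s \<in> axis_sides a. closed_segment (midpoint_of s) (0, 0, z))"

fun tile_link :: "classical_tile \<Rightarrow> R3 set" where
  "tile_link Blank = {}"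
| "tile_link (Arc c) = corner_arc c"
| "tile_link (Line a) = strand a 0"
| "tile_link (DoubleArc d) = double_arc d"
| "tile_link (Crossing a) = strand a 1 \<union> strand (other_axis a) (-1)"

definition assemble :: "nat \<Rightarrow> (nat \<Rightarrow> nat \<Rightarrow> R3 set) \<Rightarrow> R3 set" where
  "assemble n P = (\<Union>i < n. \<Union>j < n. (\<lambda>p. (2 * real j, - 2 * real i, 0) + p) ` P i j)"

definition link_of :: "nat \<Rightarrow> (nat \<Rightarrow> nat \<Rightarrow> classical_tile) \<Rightarrow> R3 set" where
  "link_of n K = assemble n (\<lambda>i j. tile_link (K i j))"

definition round_circles :: "nat \<Rightarrow> R3 set" where
  "round_circles k = {(x, y, 0) | x y. \<exists>i < k. (x - 3 * real i)\<^sup>2 + y\<^sup>2 = 1}"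

definition round_disks :: "nat \<Rightarrow> R3 set" where
  "round_disks k = {(x, y, 0) | x y. \<exists>i < k. (x - 3 * real i)\<^sup>2 + y\<^sup>2 \<le> 1}"

definition trivial_link :: "R3 set \<Rightarrow> bool" where
  "trivial_link L \<longleftrightarrow> (\<exists>k. equivalent (round_circles k) L)"

definition admissible :: "nat \<Rightarrow> mosaic \<Rightarrow> bool" where
  "admissible n M \<longleftrightarrow>
     trivial_link (link_of n (positive_resolution M)) \<and>
     trivial_link (link_of n (negative_resolution M))"


section \<open>The surface of a mosaic\<close>

text \<open>
  The cross-section of a tile at level \<open>t \<in> {-1..1}\<close>. At a marked vertex the convex hull of the four
  connection points is the saddle band: two opposite sides of this square are the arcs of the
  negative splice, the other two those of the positive splice. At a singular vertex the two
  strands pass through each other in the centre at level 0; at the levels 1 and -1 they form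
  the crossings of the positive and the negative resolution.
\<close>

fun tile_slice :: "real \<Rightarrow> tile \<Rightarrow> R3 set" where
  "tile_slice t (Classical k) = tile_link k"
| "tile_slice t (Marked d) =
     (if t > 0 then double_arc d
      else if t < 0 then double_arc (other_diagonal d)
      else convex hull (range midpoint_of))"
| "tile_slice t (Singular a) = strand a t \<union> strand (other_axis a) (- t)"

definition mosaic_slice :: "nat \<Rightarrow> mosaic \<Rightarrow> real \<Rightarrow> R3 set" where
  "mosaic_slice n M t = assemble n (\<lambda>i j. tile_slice t (M i j))"

text \<open>\<open>B\<close> is a system of disjoint tame disks in 3-space bounded by the trivial link \<open>L\<close>.\<close>

definition spanning_disks :: "R3 set \<Rightarrow> R3 set \<Rightarrow> bool" where
  "spanning_disks L B \<longleftrightarrow>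
     (\<exists>k h. orientation_preserving_homeo h \<and> h ` round_circles k = L \<and> h ` round_disks k = B)"

text \<open>
  \<open>\<Delta>\<close> is a system of disjoint trivial disks in the half-space above level 1 with boundary
  \<open>L \<times> {1}\<close>: up to a homeomorphism of the half-space fixing its boundary pointwise, it is
  a system of disks of the 3-space with the interiors pushed up to level 2.
\<close>

definition trivial_disks_above :: "R3 set \<Rightarrow> R4 set \<Rightarrow> bool" where
  "trivial_disks_above L \<Delta> \<longleftrightarrow>
     (\<exists>B (\<Phi> :: R4 \<Rightarrow> R4) \<Psi>. spanning_disks L B \<and>
        homeomorphism (UNIV \<times> {1..}) (UNIV \<times> {1..}) \<Phi> \<Psi> \<and>
        (\<forall>p. \<Phi> (p, 1) = (p, 1)) \<and>
        \<Phi> ` (L \<times> {1..2} \<union> B \<times> {2}) = \<Delta>)"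

definition trivial_disks_below :: "R3 set \<Rightarrow> R4 set \<Rightarrow> bool" where
  "trivial_disks_below L \<Delta> \<longleftrightarrow> trivial_disks_above L ((\<lambda>(p, t). (p, - t)) ` \<Delta>)"

text \<open>
  The surface \<open>F(D)\<close> of a diagram is only determined up to equivalence, hence a relation. As usual,
  the surface is given with corners (along the bands and the strands); rounding them is
  a homeomorphism of the ambient space.
\<close>

definition surface_of_mosaic :: "nat \<Rightarrow> mosaic \<Rightarrow> R4 set \<Rightarrow> bool" where
  "surface_of_mosaic n M G \<longleftrightarrow>
     (\<exists>\<Delta> \<Delta>'.
        trivial_disks_above (link_of n (positive_resolution M)) \<Delta> \<and>
        trivial_disks_below (link_of n (negative_resolution M)) \<Delta>' \<and>
        G = \<Delta> \<union> {(p, t). t \<in> {-1..1} \<and> p \<in> mosaic_slice n M t} \<union> \<Delta>')"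

definition represented_by_mosaic :: "R4 set \<Rightarrow> nat \<Rightarrow> bool" where
  "represented_by_mosaic F n \<longleftrightarrow>
     (\<exists>M G. singular_marked_graph_mosaic n M \<and> admissible n M \<and>
        surface_of_mosaic n M G \<and> equivalent G F)"

definition mosaic_number :: "R4 set \<Rightarrow> nat" where
  "mosaic_number F = (LEAST n. represented_by_mosaic F n)"

end

theory Submission
  imports Defs
begin

text \<open>\<open>mosaic_number F\<close> refers to \<open>F\<close> only through the condition
  \<open>equivalent G F\<close> on the surfaces \<open>G\<close> built from mosaics, so it depends
  only on the equivalence class of \<open>F\<close>. It remains to see that
  \<open>equivalent\<close> is symmetric and transitive, that is, that orientation-preserving
  homeomorphisms are closed under inverses and composition. Since orientation is tested by the
  action on local homology at each point, both closure properties come from functoriality of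
  relative homology.\<close>

text \<open>Makes the recentred homeomorphism a map of pairs, as functoriality requires; injectivity
  keeps the complement of the origin away from the origin.\<close>

lemma homeomorphism_shift_continuous_map:
  fixes h :: "'a::euclidean_space \<Rightarrow> 'a"
  assumes "homeomorphism UNIV UNIV h g"
  shows "continuous_map euclidean euclidean (\<lambda>x. h (a + x) - h a)"
    and "(\<lambda>x. h (a + x) - h a) \<in> - {0} \<rightarrow> - {0}"
proof -
  have "continuous_on UNIV h"
    using assms by (simp add: homeomorphism_def)
  then show "continuous_map euclidean euclidean (\<lambda>x. h (a + x) - h a)"
    by (simp add: continuous_on_diff continuous_on_add continuous_on_compose2[of UNIV h])
  have "inj h"
    using assms by (auto simp: homeomorphism_def intro: inj_on_inverseI)
  then show "(\<lambda>x. h (a + x) - h a) \<in> - {0} \<rightarrow> - {0}"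
    by (simp add: Pi_iff inj_eq)
qed

text \<open>A chain rule for local homology: recentring \<open>h\<close> at \<open>a\<close> and
  then \<open>k\<close> at \<open>h a\<close> recentres the composite at \<open>a\<close>, because
  the two occurrences of \<open>h a\<close> cancel.\<close>

lemma hom_induced_shift_compose:
  fixes h k :: "'a::euclidean_space \<Rightarrow> 'a"
  assumes "homeomorphism UNIV UNIV h h'" and "homeomorphism UNIV UNIV k k'"
  shows "hom_induced p euclidean (- {0}) euclidean (- {0}) (\<lambda>x. k (h (a + x)) - k (h a)) c =
    hom_induced p euclidean (- {0}) euclidean (- {0}) (\<lambda>y. k (h a + y) - k (h a))
      (hom_induced p euclidean (- {0}) euclidean (- {0}) (\<lambda>x. h (a + x) - h a) c)"
  using hom_induced_compose'[OF homeomorphism_shift_continuous_map[OF assms(1), of a]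
      homeomorphism_shift_continuous_map[OF assms(2), of "h a"], of p c]
  by (simp add: o_def)

lemma orientation_preserving_homeo_compose:
  fixes h k :: "'a::euclidean_space \<Rightarrow> 'a"
  assumes "orientation_preserving_homeo h" and "orientation_preserving_homeo k"
  shows "orientation_preserving_homeo (k \<circ> h)"
proof -
  obtain h' k' where h: "homeomorphism UNIV UNIV h h'" and k: "homeomorphism UNIV UNIV k k'"
    using assms by (auto simp: orientation_preserving_homeo_def)
  have "orientation_preserving (k \<circ> h)"
    \<comment> \<open>By the chain rule, a class is acted on by \<open>h\<close> at \<open>a\<close>
      and then by \<open>k\<close> at \<open>h a\<close>; each factor fixes it.\<close>
    using assms by (simp add: orientation_preserving_homeo_def orientation_preserving_def
        hom_induced_shift_compose[OF h k])
  then show ?thesis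
    using homeomorphism_compose[OF h k] by (auto simp: orientation_preserving_homeo_def)
qed

text \<open>The chain rule for \<open>g\<close> after \<open>h\<close> gives the identity, so
  \<open>g\<close> must fix every class that \<open>h\<close> fixes.\<close>

lemma orientation_preserving_homeo_inverse:
  fixes h :: "'a::euclidean_space \<Rightarrow> 'a"
  assumes "orientation_preserving h" and h: "homeomorphism UNIV UNIV h g"
  shows "orientation_preserving_homeo g"
proof -
  have g: "homeomorphism UNIV UNIV g h"
    using h by (rule homeomorphism_symD)
  have gh: "g (h x) = x" and hg: "h (g x) = x" for x
    using h by (simp_all add: homeomorphism_def)
  have "orientation_preserving g"
    unfolding orientation_preserving_def
  proof (intro allI ballI)
    fix b :: 'a and c
    let ?p = "int DIM('a)"
    let ?ind = "hom_induced ?p euclidean (- {0 :: 'a}) euclidean (- {0})"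
    assume c: "c \<in> carrier (relative_homology_group ?p euclidean (- {0 :: 'a}))"
    \<comment> \<open>The base point for \<open>h\<close> is \<open>g b\<close>, so that the
      following factor \<open>g\<close> is recentred at \<open>h (g b) = b\<close>.\<close>
    have "?ind (\<lambda>x. h (g b + x) - h (g b)) c = c"
      using assms(1) c by (simp add: orientation_preserving_def)
    then have "?ind (\<lambda>x. g (b + x) - g b) c = ?ind (\<lambda>x. x) c"
      using hom_induced_shift_compose[OF h g, of ?p "g b" c] by (simp add: gh hg)
    also have "\<dots> = c"
      using c hom_induced_id[of c ?p euclidean "- {0 :: 'a}"] by (simp add: id_def)
    finally show "?ind (\<lambda>x. g (b + x) - g b) c = c" .
  qed
  then show ?thesis
    using g by (auto simp: orientation_preserving_homeo_def)
qed

lemma equivalent_sym: "equivalent F F' \<Longrightarrow> equivalent F' F"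
proof -
  assume "equivalent F F'"
  then obtain h g where op: "orientation_preserving h"
    and h: "homeomorphism UNIV UNIV h g" and F': "h ` F = F'"
    by (auto simp: equivalent_def orientation_preserving_homeo_def)
  have "g ` F' = F"
    using h by (simp add: F'[symmetric] image_image homeomorphism_def)
  then show "equivalent F' F"
    using orientation_preserving_homeo_inverse[OF op h] by (auto simp: equivalent_def)
qed

lemma equivalent_trans: "equivalent F F' \<Longrightarrow> equivalent F' F'' \<Longrightarrow> equivalent F F''"
  unfolding equivalent_def by (metis image_comp orientation_preserving_homeo_compose)

theorem theorem4:
  fixes F F' :: "R4 set"
  assumes "immersed_surface_link F" and "immersed_surface_link F'"
    and "double_points F \<noteq> {}" and "double_points F' \<noteq> {}"
    and "equivalent F F'"
  shows "mosaic_number F = mosaic_number F'"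
proof -
  \<comment> \<open>Hence \<open>F\<close> and \<open>F'\<close> are represented by the same sizes
    of mosaic, and both \<open>LEAST\<close> terms range over one predicate.\<close>
  have "equivalent G F \<longleftrightarrow> equivalent G F'" for G
    using assms(5) by (meson equivalent_sym equivalent_trans)
  then show ?thesis
    by (simp add: mosaic_number_def represented_by_mosaic_def)
qed

end
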